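(* Let $G$ be an irreducible complex reflection group acting on $V\cong\mathbb{C}^2$. If $z\in G$ is a nonidentity central element and $G$ contains no reflection of the same order as $z$, then $\ell(z)>\operatorname{codim}(z)$.
   Context: A reflection is an element of $GL(V)$ of finite order fixing a hyperplane pointwise; a complex reflection group is a finite subgroup of $GL(V)$ generated by reflections, irreducible if $V$ is an irreducible $G$-module. $\ell(g)$ is the minimal number of reflections in $G$ whose product is $g$ ($\ell(1)=0$), and $\operatorname{codim}(g)=2-\dim\{v\in V:gv=v\}$. *)

theory Defs
  imports "HOL-Analysis.Analysis"
begin

type_synonym cmat2 = "complex^2^2"

text \<open>Fixed space of g acting on V = complex^2.\<close>
definition fixspace :: "cmat2 \<Rightarrow> (complex^2) set" where
  "fixspace g = {v. g *v v = v}"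

text \<open>codim(g) = 2 - dim_C of the fixed space (complex dimension).\<close>
definition codim :: "cmat2 \<Rightarrow> nat" where
  "codim g = 2 - vec.dim (fixspace g)"

definition mpow :: "cmat2 \<Rightarrow> nat \<Rightarrow> cmat2" where
  "mpow g n = ((\<lambda>h. g ** h) ^^ n) (mat 1)"

definition has_finite_order :: "cmat2 \<Rightarrow> bool" where
  "has_finite_order g \<longleftrightarrow> (\<exists>n>0. mpow g n = mat 1)"

definition mat_order :: "cmat2 \<Rightarrow> nat" where
  "mat_order g = (LEAST n. n > 0 \<and> mpow g n = mat 1)"

text \<open>A reflection: invertible, finite order, fixes a hyperplane (complex line in C^2)
  pointwise, and is not the identity.\<close>
definition is_reflection :: "cmat2 \<Rightarrow> bool" where
  "is_reflection g \<longleftrightarrow> invertible g \<and> has_finite_order g \<and> g \<noteq> mat 1 \<and>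
     (\<exists>H. vec.subspace H \<and> vec.dim H = 1 \<and> (\<forall>v\<in>H. g *v v = v))"

text \<open>Submonoid generated by S (for a finite set of invertible matrices this is the group generated).\<close>
inductive_set gen_by :: "cmat2 set \<Rightarrow> cmat2 set" for S where
  one: "mat 1 \<in> gen_by S"
| step: "s \<in> S \<Longrightarrow> g \<in> gen_by S \<Longrightarrow> s ** g \<in> gen_by S"

definition is_mat_group :: "cmat2 set \<Rightarrow> bool" where
  "is_mat_group G \<longleftrightarrow> mat 1 \<in> G \<and> (\<forall>g\<in>G. invertible g \<and> matrix_inv g \<in> G) \<and>
     (\<forall>g\<in>G. \<forall>h\<in>G. g ** h \<in> G)"

definition complex_reflection_group :: "cmat2 set \<Rightarrow> bool" where
  "complex_reflection_group G \<longleftrightarrow> finite G \<and> is_mat_group G \<and>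
     G = gen_by {r\<in>G. is_reflection r}"

definition irreducible_mat_group :: "cmat2 set \<Rightarrow> bool" where
  "irreducible_mat_group G \<longleftrightarrow>
     (\<forall>W. vec.subspace W \<and> (\<forall>g\<in>G. \<forall>w\<in>W. g *v w \<in> W) \<longrightarrow> W = {0} \<or> W = UNIV)"

text \<open>Reflection length: minimal number of reflections of G whose product is g.\<close>
definition refl_length :: "cmat2 set \<Rightarrow> cmat2 \<Rightarrow> nat" where
  "refl_length G g = (LEAST n. \<exists>rs. length rs = n \<and> set rs \<subseteq> {r\<in>G. is_reflection r} \<and>
       foldr (**) rs (mat 1) = g)"

end

theory Submission
  imports Defs
begin

text \<open>Since codim z \<le> 2 it suffices to exclude products of at most two reflections.
  The identity is excluded by hypothesis and a single reflection trivially has its own order.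
  If z = r1 r2, the fixed line of r2 is z-stable because z is central, so z has an
  eigenvector; the corresponding eigenspace is G-invariant, hence by irreducibility z = \<lambda> I.
  Then r1 = z r2\<inverse> acts as \<lambda> on that line while fixing its own line, so r1 is
  diagonalisable with eigenvalues 1 and \<lambda>, and r1 and z have the same order, the order of \<lambda>.\<close>

lemma span_pair_eq_UNIV:
  fixes u w :: "complex^2"
  assumes "u \<noteq> 0" "w \<notin> vec.span {u}"
  shows "vec.span {u, w} = UNIV"
proof -
  have "vec.independent {u}" using assms(1) by (simp add: vec.independent_insert)
  hence "vec.independent (insert w {u})" using assms(2) by (rule vec.independent_insertI[rotated])
  hence ind: "vec.independent {u, w}" by (simp add: insert_commute)
  have "u \<noteq> w" using assms vec.span_base by auto
  hence "vec.dim (UNIV :: (complex^2) set) \<le> card {u, w}"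
    using vec_dim_card[where 'a=complex and 'n=2] by simp
  hence "UNIV \<subseteq> vec.span {u, w}" by (intro vec.card_ge_dim_independent[OF _ ind]) auto
  thus ?thesis by auto
qed

lemma matrix_eq_on_pair:
  fixes u w :: "complex^2" and A B :: cmat2
  assumes "u \<noteq> 0" "w \<notin> vec.span {u}"
    and "A *v u = B *v u" "A *v w = B *v w"
  shows "A = B"
proof -
  have "vec.subspace {x. A *v x = B *v x}"
    unfolding vec.subspace_def by (auto simp: matrix_vector_right_distrib vector_scalar_commute)
  hence "vec.span {u, w} \<subseteq> {x. A *v x = B *v x}"
    using assms by (intro vec.span_minimal) auto
  hence "\<forall>x. A *v x = B *v x" using span_pair_eq_UNIV[OF assms(1,2)] by auto
  thus ?thesis by (simp add: matrix_eq)
qed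

lemma fixed_vector_in_span_of_fixed_vector:
  fixes g :: cmat2
  assumes "g \<noteq> mat 1" "v \<noteq> 0" "g *v v = v" "g *v w = w"
  shows "w \<in> vec.span {v}"
  using matrix_eq_on_pair[OF assms(2), of w g "mat 1"] assms by auto

lemma mpow_eigenvector:
  assumes "g *v x = c *s x"
  shows "mpow g n *v x = c ^ n *s x"
proof (induction n)
  case 0
  then show ?case by (simp add: mpow_def)
next
  case (Suc n)
  have "mpow g (Suc n) *v x = g *v (mpow g n *v x)"
    by (simp add: mpow_def matrix_vector_mul_assoc)
  also have "\<dots> = c ^ Suc n *s x"
    using Suc assms by (simp add: vector_scalar_commute vector_smult_assoc mult.commute)
  finally show ?case .
qed

lemma mpow_eq_one_iff_of_scalar:
  assumes "\<forall>x. z *v x = l *s x"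
  shows "mpow z n = mat 1 \<longleftrightarrow> l ^ n = 1"
proof -
  obtain v :: "complex^2" where "v \<noteq> 0" using zero_neq_one by blast
  have "mpow z n *v x = l ^ n *s x" for x using mpow_eigenvector assms by blast
  thus ?thesis using \<open>v \<noteq> 0\<close> vector_mul_rcancel[of "l ^ n" v 1]
    by (auto simp: matrix_eq)
qed

lemma mpow_eq_one_iff_of_eigenpair:
  fixes r :: cmat2
  assumes "u \<noteq> 0" "v \<notin> vec.span {u}" "r *v u = u" "r *v v = l *s v"
  shows "mpow r n = mat 1 \<longleftrightarrow> l ^ n = 1"
proof
  have "v \<noteq> 0" using assms(2) vec.span_zero by auto
  assume "mpow r n = mat 1"
  hence "l ^ n *s v = 1 *s v" using mpow_eigenvector[OF assms(4), of n] by simp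
  thus "l ^ n = 1" using \<open>v \<noteq> 0\<close> vector_mul_rcancel by blast
next
  assume "l ^ n = 1"
  show "mpow r n = mat 1"
    using mpow_eigenvector[OF assms(4), of n] mpow_eigenvector[of r u 1 n] assms(3) \<open>l ^ n = 1\<close>
    by (intro matrix_eq_on_pair[OF assms(1,2)]) auto
qed

lemma central_eigenvector_scalar:
  assumes "irreducible_mat_group G" "\<forall>g\<in>G. g ** z = z ** g"
    and "v \<noteq> 0" "z *v v = l *s v"
  shows "z *v x = l *s x"
proof -
  define E where "E = {x. z *v x = l *s x}"
  have "vec.subspace E"
    unfolding vec.subspace_def E_def
    by (auto simp: matrix_vector_right_distrib vector_scalar_commute vector_add_ldistrib
        vector_smult_assoc mult.commute)
  moreover have "g *v w \<in> E" if "g \<in> G" "w \<in> E" for g w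
  proof -
    have "z *v (g *v w) = g *v (z *v w)"
      using assms(2) that(1) by (metis matrix_vector_mul_assoc)
    thus ?thesis using that(2) unfolding E_def by (simp add: vector_scalar_commute)
  qed
  ultimately have "E = {0} \<or> E = UNIV"
    using assms(1) unfolding irreducible_mat_group_def by blast
  moreover have "v \<in> E" using assms(4) E_def by simp
  ultimately show ?thesis using assms(3) E_def by auto
qed

lemma reflection_fixes_nonzero:
  assumes "is_reflection r"
  obtains v where "v \<noteq> 0" "r *v v = v"
proof -
  obtain H where H: "vec.dim H = 1" "\<forall>v\<in>H. r *v v = v"
    using assms unfolding is_reflection_def by blast
  have "\<not> H \<subseteq> {0}" using H(1) vec.dim_eq_0[of H] by auto
  thus ?thesis using H(2) that by auto
qed

lemma reflection_fixes_eigenvector_of_commuting: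
  assumes "is_reflection r" "r ** z = z ** r"
  obtains v l where "v \<noteq> 0" "r *v v = v" "z *v v = l *s v"
proof -
  obtain v where v: "v \<noteq> 0" "r *v v = v" using reflection_fixes_nonzero[OF assms(1)] .
  have "r *v (z *v v) = z *v v" using assms(2) v(2) by (metis matrix_vector_mul_assoc)
  moreover have "r \<noteq> mat 1" using assms(1) unfolding is_reflection_def by simp
  ultimately have "z *v v \<in> vec.span {v}"
    using fixed_vector_in_span_of_fixed_vector v by blast
  thus ?thesis using v that by (auto simp: vec.span_singleton)
qed

lemma central_product_of_two_reflections_order:
  assumes "irreducible_mat_group G" "\<forall>g\<in>G. g ** z = z ** g" "z \<noteq> mat 1"
    and "is_reflection r\<^sub>1" "is_reflection r\<^sub>2" "r\<^sub>2 \<in> G" "z = r\<^sub>1 ** r\<^sub>2"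
  shows "mat_order r\<^sub>1 = mat_order z"
proof -
  obtain v l where v: "v \<noteq> 0" "r\<^sub>2 *v v = v" and lam: "z *v v = l *s v"
    using reflection_fixes_eigenvector_of_commuting[OF assms(5)] assms(2,6) by metis
  have scalar: "\<forall>x. z *v x = l *s x"
    using central_eigenvector_scalar[OF assms(1,2) v(1) lam] by blast
  have "l \<noteq> 1" using scalar assms(3) by (auto simp: matrix_eq)
  obtain u where u: "u \<noteq> 0" "r\<^sub>1 *v u = u" using reflection_fixes_nonzero[OF assms(4)] .
  have r1v: "r\<^sub>1 *v v = l *s v"
    using lam v(2) assms(7) by (metis matrix_vector_mul_assoc)
  have "v \<notin> vec.span {u}"
  proof
    assume "v \<in> vec.span {u}"
    then obtain c where "v = c *s u" by (auto simp: vec.span_singleton)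
    hence "l *s v = 1 *s v" using u(2) r1v by (simp add: vector_scalar_commute)
    thus False using v(1) \<open>l \<noteq> 1\<close> vector_mul_rcancel by blast
  qed
  thus ?thesis unfolding mat_order_def
    using mpow_eq_one_iff_of_eigenpair[OF u(1) _ u(2) r1v] mpow_eq_one_iff_of_scalar[OF scalar]
    by simp
qed

lemma gen_by_imp_foldr:
  "g \<in> gen_by S \<Longrightarrow> \<exists>rs. set rs \<subseteq> S \<and> foldr (**) rs (mat 1) = g"
proof (induction rule: gen_by.induct)
  case one
  then show ?case by (intro exI[of _ "[]"]) auto
next
  case (step s g)
  then obtain rs where "set rs \<subseteq> S" "foldr (**) rs (mat 1) = g" by blast
  with step show ?case by (intro exI[of _ "s # rs"]) auto
qed

lemma refl_length_attained:
  assumes "complex_reflection_group G" "g \<in> G"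
  obtains rs where "length rs = refl_length G g" "set rs \<subseteq> {r\<in>G. is_reflection r}"
    "foldr (**) rs (mat 1) = g"
proof -
  let ?P = "\<lambda>n. \<exists>rs. length rs = n \<and> set rs \<subseteq> {r\<in>G. is_reflection r} \<and>
    foldr (**) rs (mat 1) = g"
  have "g \<in> gen_by {r\<in>G. is_reflection r}"
    using assms unfolding complex_reflection_group_def by auto
  then obtain rs where "set rs \<subseteq> {r\<in>G. is_reflection r}" "foldr (**) rs (mat 1) = g"
    using gen_by_imp_foldr by blast
  hence "?P (refl_length G g)"
    unfolding refl_length_def by (intro LeastI[of ?P "length rs"]) blast
  thus ?thesis using that by blast
qed

theorem mainTheorem9:
  fixes G :: "cmat2 set" and z :: cmat2
  assumes "complex_reflection_group G"
    and "irreducible_mat_group G"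
    and "z \<in> G" and "z \<noteq> mat 1"
    and "\<forall>g\<in>G. g ** z = z ** g"
    and "\<not> (\<exists>r\<in>G. is_reflection r \<and> mat_order r = mat_order z)"
  shows "refl_length G z > codim z"
proof -
  obtain rs where rs: "length rs = refl_length G z" "set rs \<subseteq> {r\<in>G. is_reflection r}"
    "foldr (**) rs (mat 1) = z"
    using refl_length_attained[OF assms(1,3)] by blast
  have "length rs \<noteq> 0" using rs(3) assms(4) by auto
  moreover have "length rs \<noteq> 1" using rs(2,3) assms(6) by (auto simp: length_Suc_conv)
  moreover have "length rs \<noteq> 2"
  proof
    assume "length rs = 2"
    then obtain r\<^sub>1 r\<^sub>2 where "rs = [r\<^sub>1, r\<^sub>2]" by (auto simp: numeral_2_eq_2 length_Suc_conv)
    thus False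
      using rs(2,3) assms(6) central_product_of_two_reflections_order[OF assms(2,5,4)] by auto
  qed
  moreover have "codim z \<le> 2" unfolding codim_def by simp
  ultimately show ?thesis using rs(1) by linarith
qed

end
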